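(* Let $G=(V,E)$ be a finite undirected graph, let $T$ be a rooted spanning tree of $G$ with root $r_T$, and let $A\subset V$. Suppose $E(T)\cap\delta(A)=\{e_T(v_1),\dots,e_T(v_k)\}$ for some distinct vertices $v_1,\dots,v_k\in V\setminus\{r_T\}$. Then $$|\delta(A)|=\sum_{l=1}^{k}(-1)^{l-1}2^{l-1}\sum_{\substack{S'\subseteq[k]\\|S'|=l}}\Big|\bigcap_{i\in S'}\delta\big(v_i^{\downarrow T}\big)\Big|.$$
   Context: $E(T)$ is the set of edges of $T$. For a vertex $v\neq r_T$, $e_T(v)$ denotes the tree edge joining $v$ to its parent in $T$. For $v\in V$, $v^{\downarrow T}$ is the set of descendants of $v$ in $T$, including $v$ itself. For $B\subseteq V$, $\delta(B)$ is the set of edges of $G$ with exactly one endpoint in $B$ (the edges of the cut $(B,V\setminus B)$). $[k]=\{1,\dots,k\}$. *)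

theory Defs imports Main begin

definition fin_graph :: "'a set \<Rightarrow> 'a set set \<Rightarrow> bool" where
  "fin_graph V E \<longleftrightarrow> finite V \<and> (\<forall>e\<in>E. e \<subseteq> V \<and> card e = 2)"

text \<open>Paths and cycles are given by their lists of vertices, without repetition; the single-vertex
  list is the trivial path. The closing edge of a cycle joins its last vertex to its first.\<close>

definition is_path :: "'a set set \<Rightarrow> 'a \<Rightarrow> 'a list \<Rightarrow> 'a \<Rightarrow> bool" where
  "is_path F u p v \<longleftrightarrow>
     p \<noteq> [] \<and> hd p = u \<and> last p = v \<and> distinct p \<and> successively (\<lambda>x y. {x, y} \<in> F) p"

definition is_cycle :: "'a set set \<Rightarrow> 'a list \<Rightarrow> bool" where
  "is_cycle F p \<longleftrightarrow>
     3 \<le> length p \<and> distinct p \<and> successively (\<lambda>x y. {x, y} \<in> F) p \<and> {last p, hd p} \<in> F"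

definition connected_graph :: "'a set \<Rightarrow> 'a set set \<Rightarrow> bool" where
  "connected_graph V F \<longleftrightarrow> (\<forall>u\<in>V. \<forall>v\<in>V. \<exists>p. is_path F u p v)"

definition acyclic_graph :: "'a set set \<Rightarrow> bool" where
  "acyclic_graph F \<longleftrightarrow> (\<nexists>p. is_cycle F p)"

text \<open>A spanning tree has vertex set \<open>V\<close>, so it is represented by its edge set \<open>F\<close>.\<close>

definition rooted_spanning_tree :: "'a set \<Rightarrow> 'a set set \<Rightarrow> 'a set set \<Rightarrow> 'a \<Rightarrow> bool" where
  "rooted_spanning_tree V E F r \<longleftrightarrow>
     F \<subseteq> E \<and> connected_graph V F \<and> acyclic_graph F \<and> r \<in> V"

text \<open>The parent of \<open>v\<close> is the vertex following \<open>v\<close> on the tree path from \<open>v\<close> to the root;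
  it is only meaningful for \<open>v\<close> different from the root.\<close>

definition parent :: "'a set set \<Rightarrow> 'a \<Rightarrow> 'a \<Rightarrow> 'a" where
  "parent F r v = (THE w. \<exists>p. is_path F v (v # w # p) r)"

definition parent_edge :: "'a set set \<Rightarrow> 'a \<Rightarrow> 'a \<Rightarrow> 'a set" where
  "parent_edge F r v = {v, parent F r v}"

text \<open>The descendants of \<open>v\<close> are the vertices whose tree path to the root passes through \<open>v\<close>.\<close>

definition descendants :: "'a set \<Rightarrow> 'a set set \<Rightarrow> 'a \<Rightarrow> 'a \<Rightarrow> 'a set" where
  "descendants V F r v = {u \<in> V. \<exists>p. is_path F u p r \<and> v \<in> set p}"

definition cut_edges :: "'a set set \<Rightarrow> 'a set \<Rightarrow> 'a set set" where
  "cut_edges E B = {e \<in> E. card (e \<inter> B) = 1}"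

end

theory Submission imports Defs begin

text \<open>For every vertex \<open>x\<close>, following the tree path from \<open>x\<close> to the root, membership in \<open>A\<close> flips
  exactly at the edges \<open>e(v\<^sub>i)\<close> with \<open>v\<^sub>i\<close> on that path, that is, with \<open>x\<close> a descendant of \<open>v\<^sub>i\<close>.
  Hence a graph edge lies in \<open>\<delta>(A)\<close> iff it lies in an odd number of the cuts of the descendant sets.
  An edge lying in \<open>m\<close> of these cuts contributes \<open>\<Sum>l\<ge>1. (-2)\<^sup>l\<^sup>-\<^sup>1 (m choose l) = (1 - (-1)\<^sup>m) / 2\<close> to the
  right-hand side, which is 1 for odd \<open>m\<close> and 0 for even \<open>m\<close>.\<close>

section \<open>Signed subset sums and odd incidence\<close>

text \<open>Binomial expansion of \<open>(1 + (-2)) ^ card J\<close>. In the induction, the subsets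
  containing \<open>x\<close> contribute -2 times what the others contribute, so the total changes
  sign.\<close>

lemma sum_Pow_neg_two_power:
  assumes "finite J"
  shows "(\<Sum>S\<in>Pow J. (-2::int) ^ card S) = (-1) ^ card J"
  using assms
proof (induction J rule: finite_induct)
  case (insert x J)
  have disj: "Pow J \<inter> insert x ` Pow J = {}" and inj: "inj_on (insert x) (Pow J)"
    using insert.hyps by (auto simp: inj_on_def)
  have card: "card (insert x S) = Suc (card S)" if "S \<in> Pow J" for S
    using that insert.hyps by (metis PowD card_insert_disjoint finite_subset subsetD)
  have "(\<Sum>S\<in>Pow (insert x J). (-2::int) ^ card S)
      = (\<Sum>S\<in>Pow J. (-2) ^ card S) + (\<Sum>S\<in>Pow J. (-2) ^ card (insert x S))"
    unfolding Pow_insert using insert.hyps disj inj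
    by (subst sum.union_disjoint) (auto simp: sum.reindex)
  also have "\<dots> = (\<Sum>S\<in>Pow J. (-2) ^ card S) + (\<Sum>S\<in>Pow J. (-2) * (-2) ^ card S)"
    using card by simp
  also have "\<dots> = - (\<Sum>S\<in>Pow J. (-2) ^ card S)"
    by (simp add: sum_negf flip: sum_distrib_left)
  finally show ?case
    using insert by simp
qed simp

lemma sum_nonempty_subsets_neg_two_power:
  assumes "finite J"
  shows "(\<Sum>S\<in>Pow J - {{}}. (-2::int) ^ (card S - 1)) = of_bool (odd (card J))"
proof -
  \<comment> \<open>Multiplying by -2 avoids a division in the integers. For nonempty
    \<open>S\<close> it restores the full exponent, since the truncated \<open>card S - 1\<close> is
    then a true predecessor.\<close>
  have "(-2) * (\<Sum>S\<in>Pow J - {{}}. (-2::int) ^ (card S - 1)) = (\<Sum>S\<in>Pow J - {{}}. (-2) ^ card S)"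
    unfolding sum_distrib_left
  proof (rule sum.cong[OF refl])
    fix S assume "S \<in> Pow J - {{}}"
    then have "card S > 0"
      using assms by (metis Diff_iff PowD card_gt_0_iff finite_subset singletonI)
    then show "(-2::int) * (-2) ^ (card S - 1) = (-2) ^ card S"
      by (simp flip: power_Suc)
  qed
  also have "\<dots> = (-1) ^ card J - 1"
    using assms by (simp add: sum_diff1 sum_Pow_neg_two_power)
  finally show ?thesis
    by (cases "odd (card J)") auto
qed

text \<open>Double counting: after exchanging the sums, each \<open>e\<close> collects the weights
  of the nonempty subsets of its index set, and these add up to 1 or 0 by parity. No graph structure
  enters here.\<close>

lemma card_odd_incidence:
  fixes C :: "'i \<Rightarrow> 'e set"
  assumes "finite I" "finite E" and sub: "\<And>i. i \<in> I \<Longrightarrow> C i \<subseteq> E"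
  shows "int (card {e \<in> E. odd (card {i \<in> I. e \<in> C i})}) =
    (\<Sum>l = 1..card I. (-1) ^ (l - 1) * 2 ^ (l - 1) *
      (\<Sum>S | S \<subseteq> I \<and> card S = l. int (card (\<Inter>i\<in>S. C i))))"
proof -
  let ?J = "\<lambda>e. {i \<in> I. e \<in> C i}"
  let ?P = "Pow I - {{}}"
  have inter: "int (card (\<Inter>i\<in>S. C i)) = (\<Sum>e\<in>E. of_bool (S \<subseteq> ?J e))" if "S \<in> ?P" for S
  proof -
    \<comment> \<open>Nonemptiness of \<open>S\<close> matters: the empty intersection would be
      \<open>UNIV\<close>.\<close>
    have "(\<Inter>i\<in>S. C i) = {e \<in> E. S \<subseteq> ?J e}"
      using that sub by auto
    then show ?thesis
      using assms by (simp add: sum.If_cases of_bool_def Int_def)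
  qed
  have "(\<Sum>l = 1..card I. (-1) ^ (l - 1) * 2 ^ (l - 1) *
          (\<Sum>S | S \<subseteq> I \<and> card S = l. int (card (\<Inter>i\<in>S. C i))))
      = (\<Sum>l = 1..card I. \<Sum>S | S \<in> ?P \<and> card S = l. (-2) ^ (card S - 1) * int (card (\<Inter>i\<in>S. C i)))"
  proof (rule sum.cong[OF refl])
    fix l assume "l \<in> {1..card I}"
    then have "{S. S \<in> ?P \<and> card S = l} = {S. S \<subseteq> I \<and> card S = l}"
      by auto
    moreover have "(-1) ^ (l - 1) * 2 ^ (l - 1) = (-2::int) ^ (l - 1)"
      using power_mult_distrib[of "-1::int" 2 "l - 1"] by simp
    ultimately show "(-1) ^ (l - 1) * 2 ^ (l - 1) *
          (\<Sum>S | S \<subseteq> I \<and> card S = l. int (card (\<Inter>i\<in>S. C i)))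
        = (\<Sum>S | S \<in> ?P \<and> card S = l. (-2) ^ (card S - 1) * int (card (\<Inter>i\<in>S. C i)))"
      by (simp only: sum_distrib_left) (rule sum.cong[OF refl], simp)
  qed
  also have "\<dots> = (\<Sum>S\<in>?P. (-2) ^ (card S - 1) * int (card (\<Inter>i\<in>S. C i)))"
  proof (rule sum.group)
    show "card ` ?P \<subseteq> {1..card I}"
      using assms(1) by (auto simp: Suc_le_eq card_gt_0_iff card_mono dest: finite_subset)
  qed (use assms in auto)
  also have "\<dots> = (\<Sum>S\<in>?P. \<Sum>e\<in>E. (-2) ^ (card S - 1) * of_bool (S \<subseteq> ?J e))"
    by (intro sum.cong refl) (simp only: inter sum_distrib_left)
  also have "\<dots> = (\<Sum>e\<in>E. \<Sum>S\<in>?P. (-2) ^ (card S - 1) * of_bool (S \<subseteq> ?J e))"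
    by (rule sum.swap)
  also have "\<dots> = (\<Sum>e\<in>E. \<Sum>S\<in>Pow (?J e) - {{}}. (-2) ^ (card S - 1))"
    using assms(1) by (intro sum.cong[OF refl] sum.mono_neutral_cong_right) auto
  also have "\<dots> = (\<Sum>e\<in>E. of_bool (odd (card (?J e))))"
    using assms(1) by (intro sum.cong refl sum_nonempty_subsets_neg_two_power) simp
  also have "\<dots> = int (card {e \<in> E. odd (card (?J e))})"
    using assms(2) by (simp add: sum.If_cases of_bool_def Int_def)
  finally show ?thesis ..
qed

text \<open>Modulo 2, the size of a symmetric difference is the sum of the two sizes.
  \<open>P\<close> and \<open>Q\<close> will be membership of the two ends of an edge in the
  descendant sets.\<close>

lemma odd_card_xor:
  assumes "finite I"
  shows "odd (card {i \<in> I. P i \<noteq> Q i}) \<longleftrightarrow> (odd (card {i \<in> I. P i}) \<noteq> odd (card {i \<in> I. Q i}))"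
  using assms
proof (induction I rule: finite_induct)
  case (insert x I)
  have "card {i \<in> insert x I. R i} = of_bool (R x) + card {i \<in> I. R i}" for R
  proof -
    have "{i \<in> insert x I. R i} = (if R x then insert x {i \<in> I. R i} else {i \<in> I. R i})"
      by auto
    then show ?thesis
      using insert.hyps by simp
  qed
  from this[of P] this[of Q] this[of "\<lambda>i. P i \<noteq> Q i"] insert.IH show ?case
    by (cases "P x"; cases "Q x") simp_all
qed simp

section \<open>Uniqueness of paths in acyclic graphs\<close>

lemma is_path_Cons:
  assumes "is_path F u (a # b # p) v"
  shows "a = u" "{u, b} \<in> F" "is_path F b (b # p) v"
  using assms by (auto simp: is_path_def)

text \<open>Follow the first path up to the first vertex \<open>c\<close> that lies on the second,
  then return to \<open>u\<close> along the second. The choice of \<open>c\<close> keeps the two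
  segments disjoint.\<close>

lemma is_cycle_of_two_paths:
  assumes p: "is_path F u (u # a # p) v" and q: "is_path F u (u # b # q) v" and ne: "a \<noteq> b"
  shows "\<exists>c. is_cycle F c"
proof -
  let ?p = "a # p" and ?q = "b # q"
  have "last ?p = last ?q"
    using p q by (simp add: is_path_def)
  then have "\<exists>x\<in>set ?p. x \<in> set ?q"
    using last_in_set[of ?p] last_in_set[of ?q] by auto
  then obtain xs c ys where ps: "?p = xs @ c # ys" and c: "c \<in> set ?q"
    and xs: "\<forall>x\<in>set xs. x \<notin> set ?q"
    by (rule split_list_first_propE) blast
  from c obtain zs ws where qs: "?q = zs @ c # ws"
    by (metis split_list)
  have p': "distinct (u # xs @ c # ys)" "successively (\<lambda>x y. {x, y} \<in> F) (u # xs @ c # ys)"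
    using p unfolding ps[symmetric] by (auto simp: is_path_def)
  have q': "distinct (u # zs @ c # ws)" "successively (\<lambda>x y. {x, y} \<in> F) (u # zs @ c # ws)"
    using q unfolding qs[symmetric] by (auto simp: is_path_def)
  let ?c = "u # xs @ c # rev zs"
  \<comment> \<open>If \<open>xs\<close> and \<open>zs\<close> were both empty, then
    \<open>a = c = b\<close>.\<close>
  have "3 \<le> length ?c"
    using ps qs ne by (cases xs; cases zs) auto
  moreover have "distinct ?c"
    using p' q' xs unfolding qs by auto
  moreover have "successively (\<lambda>x y. {x, y} \<in> F) ((u # xs) @ c # rev zs)"
  proof -
    have "successively (\<lambda>x y. {x, y} \<in> F) ((u # xs) @ c # ys)"
      using p' by simp
    moreover have "successively (\<lambda>x y. {x, y} \<in> F) ((zs @ [c]) @ ws)"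
      using q' by (cases zs) auto
    then have "successively (\<lambda>x y. {x, y} \<in> F) (rev (zs @ [c]))"
      unfolding successively_append_iff[of _ "zs @ [c]"] successively_rev
      by (simp add: insert_commute)
    ultimately show ?thesis
      unfolding successively_append_iff by auto
  qed
  \<comment> \<open>The last vertex of \<open>?c\<close> is \<open>b\<close>, whether or not
    \<open>zs\<close> is empty, so the closing edge is the first edge of the second path.\<close>
  moreover have "{last ?c, hd ?c} \<in> F"
    using q' by (cases zs) (auto simp: insert_commute)
  ultimately have "is_cycle F ?c"
    by (simp add: is_cycle_def)
  then show ?thesis ..
qed

text \<open>Two paths with the same ends must agree in their first step, since otherwise they would
  yield a cycle; induction handles the rest.\<close>

lemma is_path_unique:
  assumes "acyclic_graph F" "is_path F u p v" "is_path F u q v"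
  shows "p = q"
  using assms(2,3)
proof (induction p arbitrary: u q)
  case Nil
  then show ?case by (simp add: is_path_def)
next
  case (Cons a p)
  show ?case
  proof (cases p)
    case Nil
    then show ?thesis
      using Cons.prems by (cases q) (auto simp: is_path_def split: if_splits)
  next
    case p: (Cons b p')
    then have "u \<noteq> v"
      using Cons.prems(1) last_in_set[of p] by (auto simp: is_path_def)
    then obtain c q' where q: "q = u # c # q'"
      using Cons.prems(2) by (cases q; cases "tl q") (auto simp: is_path_def)
    have a: "a = u"
      using Cons.prems(1) p is_path_Cons(1) by metis
    have "b = c"
      using is_cycle_of_two_paths[of F u b p' v c q'] Cons.prems assms(1)
      unfolding p q a acyclic_graph_def by blast
    moreover have "p = c # q'"
      using Cons.IH[of b "c # q'"] Cons.prems is_path_Cons(3)[of F u] \<open>b = c\<close>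
      unfolding p q a by blast
    ultimately show ?thesis
      using a q by simp
  qed
qed

section \<open>Parent edges and descendants\<close>

lemma parent_eq:
  assumes "acyclic_graph F" "is_path F v (v # w # p) r"
  shows "parent F r v = w"
  unfolding parent_def
proof (rule the_equality)
  show "\<exists>p. is_path F v (v # w # p) r"
    using assms(2) by blast
next
  fix w' assume "\<exists>p. is_path F v (v # w' # p) r"
  then obtain p' where "is_path F v (v # w' # p') r" ..
  from is_path_unique[OF assms(1) this assms(2)] show "w' = w"
    by simp
qed

text \<open>Distinct vertices sharing a parent edge would be each other's parent. The unique path
  from \<open>v'\<close> to \<open>r\<close> would then be a tail of the path from \<open>v\<close>
  and yet pass through \<open>v\<close>, which that path visits only at its start.\<close>

lemma parent_edge_eq_iff:
  assumes ac: "acyclic_graph F"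
    and v: "is_path F v (v # w # p) r" and v': "is_path F v' (v' # w' # p') r"
  shows "parent_edge F r v = parent_edge F r v' \<longleftrightarrow> v = v'"
proof
  assume "parent_edge F r v = parent_edge F r v'"
  then have eq: "{v, w} = {v', w'}"
    using parent_eq[OF ac v] parent_eq[OF ac v'] by (simp add: parent_edge_def)
  show "v = v'"
  proof (rule ccontr)
    assume "v \<noteq> v'"
    with eq have "w = v'" "w' = v"
      by (auto simp: doubleton_eq_iff)
    then have "is_path F v' (v' # p) r"
      using is_path_Cons(3)[OF v] by simp
    then have "v' # p = v' # w' # p'"
      using is_path_unique[OF ac _ v'] by blast
    then show False
      using v \<open>w' = v\<close> by (auto simp: is_path_def)
  qed
qed simp

lemma card_doubleton_Int_eq_1_iff:
  assumes "x \<noteq> y"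
  shows "card ({x, y} \<inter> B) = 1 \<longleftrightarrow> (x \<in> B) \<noteq> (y \<in> B)"
  using assms by (simp add: Int_insert_left)

lemma exists_path_to_root_Cons:
  assumes "rooted_spanning_tree V E T r" "x \<in> V - {r}"
  shows "\<exists>w p. is_path T x (x # w # p) r"
proof -
  obtain p where p: "is_path T x p r"
    using assms unfolding rooted_spanning_tree_def connected_graph_def by blast
  then obtain w p' where "p = x # w # p'"
    using assms(2) by (cases p; cases "tl p") (auto simp: is_path_def)
  with p show ?thesis by blast
qed

lemma mem_descendants_iff:
  assumes "acyclic_graph T" "x \<in> V" "is_path T x p r"
  shows "x \<in> descendants V T r v \<longleftrightarrow> v \<in> set p"
proof
  assume "x \<in> descendants V T r v"
  then obtain q where "is_path T x q r" "v \<in> set q"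
    unfolding descendants_def by blast
  then show "v \<in> set p"
    using is_path_unique[OF assms(1) _ assms(3)] by blast
next
  assume "v \<in> set p"
  then show "x \<in> descendants V T r v"
    using assms(2,3) unfolding descendants_def by blast
qed

section \<open>Parity of crossings on the way to the root\<close>

lemma parity_along_path_to_root:
  assumes tree: "rooted_spanning_tree V E T r"
    and I: "finite I" "inj_on v I" "v ` I \<subseteq> V - {r}"
    and cut: "T \<inter> cut_edges E A = (\<lambda>i. parent_edge T r (v i)) ` I"
    and p: "is_path T x p r"
  shows "(x \<in> A) \<noteq> (r \<in> A) \<longleftrightarrow> odd (card {i \<in> I. v i \<in> set p})"
  using p
proof (induction p arbitrary: x)
  case Nil
  then show ?case by (simp add: is_path_def)
next
  case (Cons a p)
  have ac: "acyclic_graph T" and TE: "T \<subseteq> E"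
    using tree by (auto simp: rooted_spanning_tree_def)
  show ?case
  proof (cases p)
    case Nil
    then have "x = r" "a = r"
      using Cons.prems by (auto simp: is_path_def)
    \<comment> \<open>The path consists of the root alone, and no \<open>v i\<close> is the
      root.\<close>
    then have "{i \<in> I. v i \<in> set (a # p)} = {}"
      using I Nil by auto
    then show ?thesis
      by (simp only: \<open>x = r\<close> card.empty) simp
  next
    case p: (Cons w p')
    have a: "a = x"
      using Cons.prems by (simp add: is_path_def)
    have path: "is_path T x (x # w # p') r"
      using Cons.prems by (simp add: p a)
    have edge: "{x, w} \<in> T"
      using is_path_Cons(2)[OF path] .
    have "x \<noteq> w"
      using path by (auto simp: is_path_def)
    \<comment> \<open>The first edge of the path is the parent edge of \<open>x\<close>, so the step
      to \<open>w\<close> crosses the cut exactly when \<open>x\<close> is one of the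
      \<open>v i\<close>.\<close>
    have "(x \<in> A) \<noteq> (w \<in> A) \<longleftrightarrow> {x, w} \<in> T \<inter> cut_edges E A"
      using card_doubleton_Int_eq_1_iff[OF \<open>x \<noteq> w\<close>] edge TE by (auto simp: cut_edges_def)
    also have "\<dots> \<longleftrightarrow> (\<exists>i\<in>I. parent_edge T r x = parent_edge T r (v i))"
      unfolding cut using parent_eq[OF ac path] by (auto simp: parent_edge_def)
    also have "\<dots> \<longleftrightarrow> (\<exists>i\<in>I. v i = x)"
    proof (intro bex_cong refl)
      fix i assume "i \<in> I"
      then obtain w' q where "is_path T (v i) (v i # w' # q) r"
        using exists_path_to_root_Cons[OF tree] I(3) by blast
      then show "parent_edge T r x = parent_edge T r (v i) \<longleftrightarrow> v i = x"
        using parent_edge_eq_iff[OF ac path] by blast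
    qed
    finally have flip: "(x \<in> A) \<noteq> (w \<in> A) \<longleftrightarrow> (\<exists>i\<in>I. v i = x)" .
    have "x \<notin> set p"
      using path p by (auto simp: is_path_def)
    have IH: "(w \<in> A) \<noteq> (r \<in> A) \<longleftrightarrow> odd (card {i \<in> I. v i \<in> set p})"
      using Cons.IH is_path_Cons(3)[OF path] p by blast
    show ?thesis
    proof (cases "\<exists>i\<in>I. v i = x")
      case True
      then obtain j where j: "j \<in> I" "v j = x" by blast
      \<comment> \<open>Injectivity of \<open>v\<close> makes \<open>j\<close> the only new index,
        so the count grows by exactly one.\<close>
      then have "{i \<in> I. v i \<in> set (a # p)} = insert j {i \<in> I. v i \<in> set p}"
        using I(2) a by (auto simp: inj_on_def)
      moreover have "j \<notin> {i \<in> I. v i \<in> set p}"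
        using j \<open>x \<notin> set p\<close> by simp
      ultimately show ?thesis
        using IH flip True I(1) by auto
    next
      case False
      then have "{i \<in> I. v i \<in> set (a # p)} = {i \<in> I. v i \<in> set p}"
        using a by auto
      then show ?thesis
        using IH flip False by auto
    qed
  qed
qed

text \<open>Both ends of an edge are compared with the root. Whether \<open>r\<close> lies in
  \<open>A\<close> cancels, and the two parities combine into the parity of the number of descendant
  sets that separate the ends.\<close>

lemma cut_edges_eq_odd_incidence:
  assumes G: "fin_graph V E" and tree: "rooted_spanning_tree V E T r"
    and I: "finite I" "inj_on v I" "v ` I \<subseteq> V - {r}"
    and cut: "T \<inter> cut_edges E A = (\<lambda>i. parent_edge T r (v i)) ` I"
  shows "cut_edges E A =
    {e \<in> E. odd (card {i \<in> I. e \<in> cut_edges E (descendants V T r (v i))})}"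
proof -
  have ac: "acyclic_graph T"
    using tree by (simp add: rooted_spanning_tree_def)
  have parity: "(x \<in> A) \<noteq> (r \<in> A) \<longleftrightarrow> odd (card {i \<in> I. x \<in> descendants V T r (v i)})"
    if x: "x \<in> V" for x
  proof -
    obtain p where "is_path T x p r"
      using tree x unfolding rooted_spanning_tree_def connected_graph_def by blast
    with parity_along_path_to_root[OF tree I cut this] mem_descendants_iff[OF ac x this]
    show ?thesis by simp
  qed
  have "e \<in> cut_edges E A \<longleftrightarrow> odd (card {i \<in> I. e \<in> cut_edges E (descendants V T r (v i))})"
    if "e \<in> E" for e
  proof -
    from that G have "e \<subseteq> V" "card e = 2"
      by (auto simp: fin_graph_def)
    then obtain x y where e: "e = {x, y}" and xy: "x \<noteq> y" "x \<in> V" "y \<in> V"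
      by (auto simp: card_2_iff)
    have mem: "e \<in> cut_edges E B \<longleftrightarrow> (x \<in> B) \<noteq> (y \<in> B)" for B
      using that card_doubleton_Int_eq_1_iff[OF xy(1)] by (simp add: cut_edges_def e)
    show ?thesis
      unfolding mem odd_card_xor[OF I(1)] parity[OF xy(2), symmetric] parity[OF xy(3), symmetric]
      by blast
  qed
  then show ?thesis
    by (auto simp: cut_edges_def)
qed

theorem theorem1p1:
  fixes V :: "'a set" and E T :: "'a set set" and r :: 'a and A :: "'a set"
    and k :: nat and v :: "nat \<Rightarrow> 'a"
  assumes "fin_graph V E"
    and "rooted_spanning_tree V E T r"
    and "A \<subseteq> V"
    and "inj_on v {1..k}"
    and "v ` {1..k} \<subseteq> V - {r}"
    and "T \<inter> cut_edges E A = (\<lambda>i. parent_edge T r (v i)) ` {1..k}"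
  shows "int (card (cut_edges E A)) =
    (\<Sum>l = 1..k. (-1) ^ (l - 1) * 2 ^ (l - 1) *
      (\<Sum>S' | S' \<subseteq> {1..k} \<and> card S' = l.
        int (card (\<Inter>i\<in>S'. cut_edges E (descendants V T r (v i))))))"
proof -
  let ?C = "\<lambda>i. cut_edges E (descendants V T r (v i))"
  have "E \<subseteq> Pow V" "finite V"
    using assms(1) by (auto simp: fin_graph_def)
  then have "finite E"
    using finite_subset by blast
  moreover have "?C i \<subseteq> E" for i
    by (auto simp: cut_edges_def)
  ultimately have "int (card {e \<in> E. odd (card {i \<in> {1..k}. e \<in> ?C i})}) =
      (\<Sum>l = 1..card {1..k}. (-1) ^ (l - 1) * 2 ^ (l - 1) *
        (\<Sum>S | S \<subseteq> {1..k} \<and> card S = l. int (card (\<Inter>i\<in>S. ?C i))))"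
    by (intro card_odd_incidence) auto
  then show ?thesis
    using cut_edges_eq_odd_incidence[OF assms(1,2) finite_atLeastAtMost assms(4,5,6)] by simp
qed

end
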